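(* Let $\alpha,\beta,\gamma,a,b,c,z\in\mathbb{C}$ and $p\ge 0$ with $\mathrm{Re}(\alpha)>0$, $\mathrm{Re}(c)>\mathrm{Re}(b)>0$ and $|z|<1$. Then for every integer $n\ge 0$, $$\frac{d^n}{dz^n}\left[{}^{ML}F_{p}(a,b;c;z)\right]=\frac{(b)_n(a)_n}{(c)_n}\;{}^{ML}F_{p}(a+n,b+n;c+n;z).$$
   Context: The three-parameter Mittag-Leffler function is $E_{\alpha,\beta}^{\gamma}(z)=\sum_{n=0}^{\infty}\frac{(\gamma)_n}{\Gamma(\alpha n+\beta)}\frac{z^n}{n!}$ for $\alpha,\beta,\gamma\in\mathbb{C}$, $\mathrm{Re}(\alpha)>0$, where $(\gamma)_n=\gamma(\gamma+1)\cdots(\gamma+n-1)$, $(\gamma)_0=1$. The ML-generalized beta function is ${}^{ML}B_{p}(x,y)=\int_{0}^{1}t^{x-1}(1-t)^{y-1}E_{\alpha,\beta}^{\gamma}\left(-\frac{p}{t(1-t)}\right)dt$ for $\mathrm{Re}(x)>0$, $\mathrm{Re}(y)>0$ (the parameters $\alpha,\beta,\gamma$ are suppressed in the notation), and $B(x,y)=\int_0^1 t^{x-1}(1-t)^{y-1}dt$ is the classical beta function. The ML-generalized Gauss hypergeometric function is ${}^{ML}F_{p}(a,b;c;z)=\sum_{n=0}^{\infty}(a)_n\frac{{}^{ML}B_{p}(b+n,c-b)}{B(b,c-b)}\frac{z^n}{n!}$ for $p\ge 0$, $|z|<1$, $\mathrm{Re}(c)>\mathrm{Re}(b)>0$, $\mathrm{Re}(\alpha)>0$.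 *)

theory Defs
  imports "HOL-Analysis.Analysis"
begin

(* rGamma is the reciprocal Gamma function, which is 0 at the poles of Gamma; so beta is
   unrestricted, as usual for Mittag-Leffler functions.  The series converges for every z
   when Re alpha > 0. *)
definition mittag_leffler3 :: "complex \<Rightarrow> complex \<Rightarrow> complex \<Rightarrow> complex \<Rightarrow> complex" where
  "mittag_leffler3 \<alpha> \<beta> \<gamma> z =
     (\<Sum>n. pochhammer \<gamma> n * rGamma (\<alpha> * of_nat n + \<beta>) * (z ^ n / fact n))"

(* Meaningful for Re x > 0 and Re y > 0.  The library only relates its Beta, a quotient of
   Gamma values, to this integral for real arguments. *)
definition beta_integral :: "complex \<Rightarrow> complex \<Rightarrow> complex" where
  "beta_integral x y =
     integral {0..1} (\<lambda>t::real. of_real t powr (x - 1) * of_real (1 - t) powr (y - 1))"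

(* The Henstock-Kurzweil integral covers both the Lebesgue integral and conditionally
   convergent improper integrals; it is 0 if the integral does not exist.  The values of the
   integrand at the endpoints t = 0 and t = 1 are irrelevant. *)
definition ml_beta ::
    "complex \<Rightarrow> complex \<Rightarrow> complex \<Rightarrow> real \<Rightarrow> complex \<Rightarrow> complex \<Rightarrow> complex" where
  "ml_beta \<alpha> \<beta> \<gamma> p x y =
     integral {0..1} (\<lambda>t::real. of_real t powr (x - 1) * of_real (1 - t) powr (y - 1) *
       mittag_leffler3 \<alpha> \<beta> \<gamma> (of_real (- p / (t * (1 - t)))))"

definition ml_hypergeo ::
    "complex \<Rightarrow> complex \<Rightarrow> complex \<Rightarrow> real \<Rightarrow> complex \<Rightarrow> complex \<Rightarrow> complex \<Rightarrow> complex \<Rightarrow> complex"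
  where
  "ml_hypergeo \<alpha> \<beta> \<gamma> p a b c z =
     (\<Sum>n. pochhammer a n *
        (ml_beta \<alpha> \<beta> \<gamma> p (b + of_nat n) (c - b) / beta_integral b (c - b)) *
        (z ^ n / fact n))"

end

theory Submission
  imports Defs
begin

text \<open>
  The modified beta values occurring in the series for the parameters \<open>(a, b, c)\<close> are the moments
  \<open>\<integral> t^n f(t) dt\<close> of one function \<open>f\<close> on \<open>[0,1]\<close>, and passing to \<open>(a + 1, b + 1, c + 1)\<close> shifts the
  moments by one. Since the moments are bounded and \<open>\<Sum> (a)_n z^n / n!\<close> converges
  for \<open>|z| < 1\<close>, the series can be differentiated termwise there; the factor \<open>b / c\<close> comes from
  \<open>B(b + 1, c - b) = (b / c) B(b, c - b)\<close>.

  For some parameters the integral defining a moment does not exist, and the moment is then \<open>0\<close>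
  by convention. Boundedness survives: by the second mean value theorem, existence
  of one moment implies existence and a uniform bound for all later ones.
\<close>

section \<open>Boundedness of moments\<close>

text \<open>The weight \<open>t ^ k\<close> increases from \<open>0 ^ k\<close> to 1, so the second
  mean value theorem turns each moment into at most two integrals of \<open>f\<close> over
  subintervals ending at 0 or 1. These are bounded independently of \<open>k\<close>, because
  indefinite integrals are continuous on a compact interval.\<close>

lemma moments_bounded_real:
  fixes f :: "real \<Rightarrow> real"
  assumes "f integrable_on {0..1}"
  shows "\<exists>B. \<forall>k. (\<lambda>t. t ^ k * f t) integrable_on {0..1} \<and>
    \<bar>integral {0..1} (\<lambda>t. t ^ k * f t)\<bar> \<le> B"
proof -
  have "bounded ((\<lambda>x. integral {0..x} f) ` {0..1})" "bounded ((\<lambda>x. integral {x..1} f) ` {0..1})"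
    using assms
    by (auto intro!: compact_imp_bounded compact_continuous_image
        indefinite_integral_continuous_1 indefinite_integral_continuous_1')
  then obtain B1 B2 where
    B1: "\<And>x. x \<in> {0..1} \<Longrightarrow> \<bar>integral {0..x} f\<bar> \<le> B1" and
    B2: "\<And>x. x \<in> {0..1} \<Longrightarrow> \<bar>integral {x..1} f\<bar> \<le> B2"
    unfolding bounded_iff by (metis image_eqI real_norm_def)
  have "(\<lambda>t. t ^ k * f t) integrable_on {0..1} \<and>
    \<bar>integral {0..1} (\<lambda>t. t ^ k * f t)\<bar> \<le> B1 + B2" for k
  proof -
    obtain c where c: "c \<in> {0..1}" and
      I: "((\<lambda>t. t ^ k * f t) has_integral (0 ^ k * integral {0..c} f + 1 ^ k * integral {c..1} f)) {0..1}"
      by (rule second_mean_value_theorem_full[OF assms, where g = "\<lambda>t. t ^ k"])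
        (auto intro: power_mono)
    have "\<bar>0 ^ k * integral {0..c} f + 1 ^ k * integral {c..1} f\<bar> \<le> B1 + B2"
      using B1[OF c] B2[OF c] by (auto simp: power_0_left)
    with I show ?thesis
      by (auto simp: has_integral_iff)
  qed
  then show ?thesis by blast
qed

lemma moments_bounded_complex:
  fixes f :: "real \<Rightarrow> complex"
  assumes "f integrable_on {0..1}"
  shows "\<exists>B. \<forall>k. norm (integral {0..1} (\<lambda>t. of_real t ^ k * f t)) \<le> B"
proof -
  have "(\<lambda>t. Re (f t)) integrable_on {0..1}" "(\<lambda>t. Im (f t)) integrable_on {0..1}"
    using integrable_linear[OF assms bounded_linear_Re] integrable_linear[OF assms bounded_linear_Im]
    by (simp_all add: o_def)
  then obtain B1 B2 where
    B1: "\<And>k. (\<lambda>t. t ^ k * Re (f t)) integrable_on {0..1}"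
        "\<And>k. \<bar>integral {0..1} (\<lambda>t. t ^ k * Re (f t))\<bar> \<le> B1" and
    B2: "\<And>k. (\<lambda>t. t ^ k * Im (f t)) integrable_on {0..1}"
        "\<And>k. \<bar>integral {0..1} (\<lambda>t. t ^ k * Im (f t))\<bar> \<le> B2"
    using moments_bounded_real by meson
  have "norm (integral {0..1} (\<lambda>t. of_real t ^ k * f t)) \<le> B1 + B2" for k
  proof -
    let ?g = "\<lambda>t. of_real t ^ k * f t"
    have parts: "Re (?g t) = t ^ k * Re (f t)" "Im (?g t) = t ^ k * Im (f t)" for t
      by (simp_all flip: of_real_power)
    have int: "?g integrable_on {0..1}"
      by (rule integrable_componentwise)
        (use B1(1)[of k] B2(1)[of k] parts in \<open>auto simp: Basis_complex_def inner_complex_def\<close>)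
    have "Re (integral {0..1} ?g) = integral {0..1} (\<lambda>t. t ^ k * Re (f t))"
         "Im (integral {0..1} ?g) = integral {0..1} (\<lambda>t. t ^ k * Im (f t))"
      using integral_linear[OF int bounded_linear_Re] integral_linear[OF int bounded_linear_Im]
      by (simp_all only: o_def parts)
    then show ?thesis
      using cmod_le[of "integral {0..1} ?g"] B1(2)[of k] B2(2)[of k] by linarith
  qed
  then show ?thesis by blast
qed

text \<open>Either no moment exists and all values are 0, or some moment \<open>m\<close> exists.
  Then the moments from \<open>m\<close> on are those of \<open>t ^ m * f t\<close>, hence uniformly
  bounded, and only finitely many values precede them.\<close>

lemma bounded_moments:
  fixes f :: "real \<Rightarrow> complex"
  shows "bounded (range (\<lambda>k. integral {0..1} (\<lambda>t. of_real t ^ k * f t)))"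
proof (cases "\<exists>m. (\<lambda>t. of_real t ^ m * f t) integrable_on {0..1}")
  case False
  then have "integral {0..1} (\<lambda>t. of_real t ^ k * f t) = 0" for k
    by (blast intro: not_integrable_integral)
  then show ?thesis by simp
next
  case True
  then obtain m where "(\<lambda>t. of_real t ^ m * f t) integrable_on {0..1}" ..
  from moments_bounded_complex[OF this] obtain B where
    B: "\<And>k. norm (integral {0..1} (\<lambda>t. of_real t ^ k * (of_real t ^ m * f t))) \<le> B"
    by blast
  let ?M = "\<lambda>k. integral {0..1} (\<lambda>t. of_real t ^ k * f t)"
  have "?M k \<in> ?M ` {..<m} \<union> cball 0 B" for k
  proof (cases "k < m")
    case False
    then have "?M k = integral {0..1} (\<lambda>t. of_real t ^ (k - m) * (of_real t ^ m * f t))"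
      by (simp flip: mult.assoc power_add)
    with B[of "k - m"] show ?thesis by simp
  qed auto
  then have "range ?M \<subseteq> ?M ` {..<m} \<union> cball 0 B" by blast
  then show ?thesis
    by (rule bounded_subset[rotated]) (simp add: finite_imp_bounded)
qed

section \<open>Beta integrals\<close>

lemma of_real_powr_add_nat:
  "of_real t powr (x + of_nat n - 1) = of_real t ^ n * of_real t powr (x - 1)" if "t \<ge> 0"
    for t :: real and x :: complex
\<comment> \<open>At \<open>t = 0\<close> both sides vanish, since \<open>powr\<close> with base 0
  is 0 for every exponent.\<close>
proof (cases "t = 0")
  case False
  have "x + of_nat n - 1 = of_nat n + (x - 1)" by simp
  with False show ?thesis
    by (simp only: powr_add) (simp add: powr_nat')
qed auto

lemma bounded_ml_beta: "bounded (range (\<lambda>n. ml_beta \<alpha> \<beta> \<gamma> p (x + of_nat n) y))"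
proof -
  define f where "f = (\<lambda>t::real. of_real t powr (x - 1) * of_real (1 - t) powr (y - 1) *
       mittag_leffler3 \<alpha> \<beta> \<gamma> (of_real (- p / (t * (1 - t)))))"
  have "ml_beta \<alpha> \<beta> \<gamma> p (x + of_nat n) y = integral {0..1} (\<lambda>t. of_real t ^ n * f t)" for n
    unfolding ml_beta_def f_def
    by (intro integral_cong) (simp add: of_real_powr_add_nat mult.assoc)
  then show ?thesis
    using bounded_moments[of f] by simp
qed

text \<open>The combination of the two integrands is the derivative of \<open>t^x (1 - t)^y\<close>, which vanishes
  at both endpoints.\<close>

lemma beta_integral_plus1:
  assumes x: "Re x > 0" and y: "Re y > 0"
  shows "beta_integral (x + 1) y = x / (x + y) * beta_integral x y"
proof -
  define f where "f = (\<lambda>t::real. of_real t powr (x - 1) * of_real (1 - t) powr (y - 1))"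
  have xy: "x \<noteq> 0" "x + y \<noteq> 0"
    using x y by (auto simp: complex_eq_iff)
  have B0: "beta_integral x y = integral {0..1} f"
    by (simp add: beta_integral_def f_def)
  have B1: "beta_integral (x + 1) y = integral {0..1} (\<lambda>t. of_real t * f t)"
    unfolding beta_integral_def f_def
    by (intro integral_cong) (use of_real_powr_add_nat[of _ x 1] in \<open>simp add: mult.assoc\<close>)
  let ?u = "\<lambda>t::real. of_real t powr x * of_real (1 - t) powr y :: complex"
  let ?d = "\<lambda>t::real. x * f t - (x + y) * (of_real t * f t)"
  have "(?d has_integral (?u 1 - ?u 0)) {0..1}"
  proof (rule fundamental_theorem_of_calculus_interior)
    show "continuous_on {0..1} ?u"
      using x y by (intro continuous_intros) auto
    fix t :: real assume t: "t \<in> {0<..<1}"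
    let ?t = "of_real t :: complex"
    \<comment> \<open>Both bases avoid the branch cut, so the product can be differentiated in a
      complex variable and then restricted to the real line.\<close>
    have dom: "?t \<notin> \<real>\<^sub>\<le>\<^sub>0" "1 - ?t \<notin> \<real>\<^sub>\<le>\<^sub>0"
      using t by (auto simp: complex_nonpos_Reals_iff)
    then have nz: "?t \<noteq> 0" "1 - ?t \<noteq> 0"
      by fastforce+
    have p: "?t powr x = ?t * ?t powr (x - 1)" "(1 - ?t) powr y = (1 - ?t) * (1 - ?t) powr (y - 1)"
      using nz by (simp_all add: powr_diff)
    have "((\<lambda>s. (1 - s) powr y) has_field_derivative y * (1 - ?t) powr (y - 1) * (0 - 1)) (at ?t)"
      by (rule DERIV_chain2[where g = "\<lambda>s. 1 - s", OF has_field_derivative_powr[OF dom(2)]])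
        (intro derivative_intros)
    from DERIV_mult[OF has_field_derivative_powr[OF dom(1)] this]
    have "((\<lambda>s. s powr x * (1 - s) powr y) has_field_derivative
        (x * ?t powr (x - 1)) * (1 - ?t) powr y + (y * (1 - ?t) powr (y - 1) * (0 - 1)) * ?t powr x) (at ?t)" .
    then have "((\<lambda>s. s powr x * (1 - s) powr y) has_field_derivative ?d t) (at ?t)"
    proof (rule DERIV_cong)
      have alg: "x * A * ((1 - s) * D) + y * D * (0 - 1) * (s * A) = x * (A * D) - (x + y) * (s * (A * D))"
        for s A D :: complex
        by (simp add: algebra_simps)
      show "x * ?t powr (x - 1) * (1 - ?t) powr y + y * (1 - ?t) powr (y - 1) * (0 - 1) * ?t powr x = ?d t"
        unfolding p by (simp only: f_def alg of_real_diff of_real_1)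
    qed
    from has_vector_derivative_real_field[OF this]
    show "(?u has_vector_derivative ?d t) (at t)" by simp
  qed simp
  then have d: "(?d has_integral 0) {0..1}" by simp
  show ?thesis
  \<comment> \<open>As \<open>?d\<close> is integrable and both \<open>x\<close> and
    \<open>x + y\<close> are nonzero, \<open>f\<close> and \<open>t * f t\<close> are integrable
    together or not at all. In the second case both beta values are 0 and the identity
    persists.\<close>
  proof (cases "f integrable_on {0..1}")
    case True
    have "(\<lambda>t. (x * f t - ?d t) / (x + y)) integrable_on {0..1}"
      by (rule integrable_on_divide[OF integrable_diff[OF integrable_on_mult_right[OF True]
              has_integral_integrable[OF d]]])
    then have tf: "(\<lambda>t. of_real t * f t) integrable_on {0..1}"
      using xy by simp
    have "integral {0..1} ?d = x * integral {0..1} f - (x + y) * integral {0..1} (\<lambda>t. of_real t * f t)"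
      using True tf by (subst integral_diff) (auto intro!: integrable_on_mult_right)
    then show ?thesis
      unfolding B0 B1 using integral_unique[OF d] xy by (simp add: field_simps)
  next
    case False
    have "\<not> (\<lambda>t. of_real t * f t) integrable_on {0..1}"
    proof
      assume tf: "(\<lambda>t. of_real t * f t) integrable_on {0..1}"
      have "(\<lambda>t. (?d t + (x + y) * (of_real t * f t)) / x) integrable_on {0..1}"
        by (rule integrable_on_divide[OF integrable_add[OF has_integral_integrable[OF d]
                integrable_on_mult_right[OF tf]]])
      with False xy show False by simp
    qed
    with False show ?thesis
      by (simp add: B0 B1 not_integrable_integral)
  qed
qed

section \<open>The hypergeometric series\<close>

text \<open>Up to sign, \<open>pochhammer a n / fact n\<close> is the binomial coefficient of
  \<open>- a\<close> over \<open>n\<close>, so a multiple of the binomial series, absolutely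
  convergent on the unit disc, dominates.\<close>

lemma summable_pochhammer_bounded:
  fixes a z :: complex
  assumes M: "bounded (range M)" and z: "norm z < 1"
  shows "summable (\<lambda>n. pochhammer a n * M n / fact n * z ^ n)"
proof -
  obtain B where B: "\<And>n. norm (M n) \<le> B"
    using M by (auto simp: bounded_iff)
  have "ereal (norm z) < conv_radius (\<lambda>n. (- a) gchoose n)"
    using z by (simp add: conv_radius_gchoose)
  then have "summable (\<lambda>n. B * norm (((- a) gchoose n) * z ^ n))"
    by (intro summable_mult abs_summable_in_conv_radius)
  then show ?thesis
  proof (rule summable_comparison_test')
    fix n
    have "norm (pochhammer a n * M n / fact n * z ^ n) = norm (M n) * norm (((- a) gchoose n) * z ^ n)"
      by (simp add: gbinomial_pochhammer norm_mult norm_divide norm_power)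
    also have "\<dots> \<le> B * norm (((- a) gchoose n) * z ^ n)"
      using B by (intro mult_right_mono) auto
    finally show "norm (pochhammer a n * M n / fact n * z ^ n) \<le> B * norm (((- a) gchoose n) * z ^ n)" .
  qed
qed

lemma has_field_derivative_ml_hypergeo:
  fixes z :: complex
  assumes bc: "Re c > Re b" "Re b > 0" and z: "norm z < 1"
  shows "(ml_hypergeo \<alpha> \<beta> \<gamma> p a b c has_field_derivative
    b * a / c * ml_hypergeo \<alpha> \<beta> \<gamma> p (a + 1) (b + 1) (c + 1) z) (at z)"
proof -
  define M where "M n = ml_beta \<alpha> \<beta> \<gamma> p (b + of_nat n) (c - b)" for n
  define C where "C n = pochhammer a n * (M n / beta_integral b (c - b)) / fact n" for n
  have nz: "b \<noteq> 0" "c \<noteq> 0"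
    using bc by (auto simp: complex_eq_iff)
  have bM: "bounded (range M)"
    unfolding M_def by (rule bounded_ml_beta)
  have F: "ml_hypergeo \<alpha> \<beta> \<gamma> p a b c = (\<lambda>w. \<Sum>n. C n * w ^ n)"
    by (simp add: ml_hypergeo_def C_def M_def fun_eq_iff)
  have summ: "summable (\<lambda>n. C n * w ^ n)" if "norm w < 1" for w
    using summable_divide[OF summable_pochhammer_bounded[OF bM that, of a], of "beta_integral b (c - b)"]
    by (simp add: C_def mult_ac)
  have D: "((\<lambda>w. \<Sum>n. C n * w ^ n) has_field_derivative (\<Sum>n. diffs C n * z ^ n)) (at z)"
    by (rule termdiffs_strong'[OF summ z])
  \<comment> \<open>The shift of the parameters leaves \<open>c - b\<close> unchanged, and
    \<open>b + (c - b)\<close> is \<open>c\<close>.\<close>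
  have beta: "beta_integral (b + 1) (c - b) = b / c * beta_integral b (c - b)"
    using beta_integral_plus1[of b "c - b"] bc by simp
  define T where "T n = pochhammer (a + 1) n *
      (ml_beta \<alpha> \<beta> \<gamma> p (b + 1 + of_nat n) (c - b) / beta_integral (b + 1) (c - b)) * (z ^ n / fact n)" for n
  \<comment> \<open>The factor \<open>n + 1\<close> from \<open>diffs\<close> cancels against the
    factorial, and \<open>pochhammer a (Suc n)\<close> splits off \<open>a\<close>. Should the beta
    value be 0, both sides are 0 by division by zero.\<close>
  have term_eq: "diffs C n * z ^ n = b * a / c * T n" for n
  proof -
    have "ml_beta \<alpha> \<beta> \<gamma> p (b + 1 + of_nat n) (c - b) = M (Suc n)"
      by (simp add: M_def add_ac)
    then have "T n = pochhammer (a + 1) n * (M (Suc n) / (b / c * beta_integral b (c - b))) * (z ^ n / fact n)"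
      by (simp add: T_def beta)
    moreover have "diffs C n = a * pochhammer (a + 1) n * (M (Suc n) / beta_integral b (c - b)) / fact n"
      by (simp add: diffs_def C_def pochhammer_rec fact_Suc del: of_nat_Suc)
    ultimately show ?thesis
      using nz by simp
  qed
  \<comment> \<open>Convergence allows the constant \<open>b * a / c\<close> to be pulled out of the
    infinite sum.\<close>
  have "summable T"
  proof -
    have "summable (\<lambda>n. pochhammer (a + 1) n *
        ml_beta \<alpha> \<beta> \<gamma> p (b + 1 + of_nat n) (c - b) / fact n * z ^ n)"
      by (intro summable_pochhammer_bounded bounded_ml_beta z)
    from summable_divide[OF this, of "beta_integral (b + 1) (c - b)"] show ?thesis
      unfolding T_def by (simp add: mult_ac)
  qed
  then have "(\<Sum>n. diffs C n * z ^ n) = b * a / c * ml_hypergeo \<alpha> \<beta> \<gamma> p (a + 1) (b + 1) (c + 1) z"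
    unfolding term_eq by (subst suminf_mult) (simp_all add: ml_hypergeo_def T_def [abs_def])
  with D F show ?thesis by simp
qed

text \<open>Induction on \<open>n\<close>: the first derivative formula applies again at the shifted
  parameters, which still satisfy the inequalities on real parts. The new factors extend the three
  Pochhammer symbols.\<close>

lemma higher_deriv_ml_hypergeo:
  assumes bc: "Re c > Re b" "Re b > 0" and z: "norm z < 1"
  shows "(deriv ^^ n) (ml_hypergeo \<alpha> \<beta> \<gamma> p a b c) z =
      pochhammer b n * pochhammer a n / pochhammer c n *
      ml_hypergeo \<alpha> \<beta> \<gamma> p (a + of_nat n) (b + of_nat n) (c + of_nat n) z" (is "?P n z")
    and "(deriv ^^ n) (ml_hypergeo \<alpha> \<beta> \<gamma> p a b c) field_differentiable (at z)"
proof -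
  let ?F = "\<lambda>n. ml_hypergeo \<alpha> \<beta> \<gamma> p (a + of_nat n) (b + of_nat n) (c + of_nat n)"
  let ?K = "\<lambda>n. pochhammer b n * pochhammer a n / pochhammer c n"
  have step: "((deriv ^^ n) (ml_hypergeo \<alpha> \<beta> \<gamma> p a b c) has_field_derivative ?K (Suc n) * ?F (Suc n) w) (at w)"
    if P: "\<And>w. norm w < 1 \<Longrightarrow> ?P n w" and w: "norm w < 1" for n w
  proof -
    have "(?F n has_field_derivative
        (b + of_nat n) * (a + of_nat n) / (c + of_nat n) * ?F (Suc n) w) (at w)"
      using has_field_derivative_ml_hypergeo[of "b + of_nat n" "c + of_nat n" w \<alpha> \<beta> \<gamma> p "a + of_nat n"]
        bc w by (simp add: add_ac)
    from DERIV_cmult[OF this, of "?K n"]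
    have "((\<lambda>w. ?K n * ?F n w) has_field_derivative ?K (Suc n) * ?F (Suc n) w) (at w)"
      by (rule DERIV_cong) (simp add: pochhammer_Suc mult_ac)
    then show ?thesis
      \<comment> \<open>Equality at the single point \<open>w\<close> would not determine a
        derivative; the formula for \<open>n\<close> is used on the whole open unit disc.\<close>
      by (rule has_field_derivative_transform_within_open[where S = "ball 0 1"]) (use P w in auto)
  qed
  have P: "?P n w" if "norm w < 1" for n w
    using that by (induction n arbitrary: w) (simp_all add: DERIV_imp_deriv[OF step] del: pochhammer_Suc of_nat_Suc)
  show "?P n z" using P z .
  show "(deriv ^^ n) (ml_hypergeo \<alpha> \<beta> \<gamma> p a b c) field_differentiable (at z)"
    using step[OF P z] by (auto simp: field_differentiable_def)
qed

text \<open>Since \<open>deriv\<close> is a total operator, the differentiability conjunct ensures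
  that the iterated derivatives up to order \<open>n\<close> are genuine ones.\<close>

theorem theorem3p3:
  fixes \<alpha> \<beta> \<gamma> a b c z :: complex and p :: real and n :: nat
  assumes "p \<ge> 0"
    and "Re \<alpha> > 0"
    and "Re c > Re b"
    and "Re b > 0"
    and "norm z < 1"
  shows "(\<forall>k<n. (deriv ^^ k) (ml_hypergeo \<alpha> \<beta> \<gamma> p a b c) field_differentiable (at z)) \<and>
    (deriv ^^ n) (ml_hypergeo \<alpha> \<beta> \<gamma> p a b c) z =
      pochhammer b n * pochhammer a n / pochhammer c n *
      ml_hypergeo \<alpha> \<beta> \<gamma> p (a + of_nat n) (b + of_nat n) (c + of_nat n) z"
  using assms(3-5) higher_deriv_ml_hypergeo by blast

end
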